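(* The variety $\mathbf{DmsSt}$ of dually ms Stone semi-Heyting algebras is at level $2$; that is, every dually ms Stone semi-Heyting algebra satisfies the identity $t_2(x)\approx t_3(x)$.
   Context: A semi-Heyting algebra is an algebra $\langle L,\vee,\wedge,\to,0,1\rangle$ such that $\langle L,\vee,\wedge,0,1\rangle$ is a bounded lattice and the identities $x\wedge(x\to y)\approx x\wedge y$, $x\wedge(y\to z)\approx x\wedge[(x\wedge y)\to(x\wedge z)]$, and $x\to x\approx 1$ hold; $x^* := x\to 0$ is the pseudocomplement. A dually quasi-De Morgan semi-Heyting algebra is an algebra $\langle L,\vee,\wedge,\to,{}',0,1\rangle$ whose reduct $\langle L,\vee,\wedge,\to,0,1\rangle$ is a semi-Heyting algebra and which satisfies $0'\approx 1$, $1'\approx 0$, $(x\wedge y)'\approx x'\vee y'$, $(x\vee y)''\approx x''\vee y''$, and $x''\le x$. A dually ms Stone semi-Heyting algebra is a dually quasi-De Morgan semi-Heyting algebra that additionally satisfies $(x\vee y)'\approx x'\wedge y'$ and the Stone identity $x^*\vee x^{**}\approx 1$. Define $x^{0('^* )} := x$, $x^{(k+1)('^* )} := ((x^{k('^* )})')^*$, $t_0(x):=x$, $t_{k+1}(x):=t_k(x)\wedge x^{(k+1)('^* )}$. A variety is at level $n$ if it satisfies $t_n(x)\approx t_{n+1}(x)$. *)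

theory Defs
  imports Main
begin

unbundle lattice_syntax

text \<open>
  The members of a variety are the types of the corresponding type class; the lattice
  constants 0 and 1 are \<open>\<bottom>\<close> and \<open>\<top>\<close>. The one-element algebra (\<open>\<bottom> = \<top>\<close>) is not excluded.
\<close>

class semi_heyting_algebra = bounded_lattice +
  fixes sh_imp :: "'a \<Rightarrow> 'a \<Rightarrow> 'a"  (infixr "\<rightarrow>" 60)
  assumes inf_sh_imp: "x \<sqinter> (x \<rightarrow> y) = x \<sqinter> y"
    and inf_sh_imp_inf: "x \<sqinter> (y \<rightarrow> z) = x \<sqinter> ((x \<sqinter> y) \<rightarrow> (x \<sqinter> z))"
    and sh_imp_refl: "x \<rightarrow> x = \<top>"
begin

definition pseudocompl :: "'a \<Rightarrow> 'a" where
  "pseudocompl x = x \<rightarrow> \<bottom>"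

end

class dually_quasi_De_Morgan_semi_heyting_algebra = semi_heyting_algebra +
  fixes dneg :: "'a \<Rightarrow> 'a"
  assumes dneg_bot: "dneg \<bottom> = \<top>"
    and dneg_top: "dneg \<top> = \<bottom>"
    and dneg_inf: "dneg (x \<sqinter> y) = dneg x \<squnion> dneg y"
    and dneg_dneg_sup: "dneg (dneg (x \<squnion> y)) = dneg (dneg x) \<squnion> dneg (dneg y)"
    and dneg_dneg_le: "dneg (dneg x) \<le> x"
begin

text \<open>\<open>dneg_star_iter k x\<close> iterates \<open>x \<mapsto> x'\<^sup>*\<close>: the prime is applied before the pseudocomplement.\<close>

primrec dneg_star_iter :: "nat \<Rightarrow> 'a \<Rightarrow> 'a" where
  "dneg_star_iter 0 x = x"
| "dneg_star_iter (Suc k) x = pseudocompl (dneg (dneg_star_iter k x))"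

primrec level_term :: "nat \<Rightarrow> 'a \<Rightarrow> 'a" where
  "level_term 0 x = x"
| "level_term (Suc k) x = level_term k x \<sqinter> dneg_star_iter (Suc k) x"

end

text \<open>
  A type satisfies the level-\<open>n\<close> identity; a variety is at level \<open>n\<close> iff this holds
  for every type of its class.
\<close>

definition at_level :: "'a::dually_quasi_De_Morgan_semi_heyting_algebra itself \<Rightarrow> nat \<Rightarrow> bool" where
  "at_level _ n \<longleftrightarrow> (\<forall>x::'a. level_term n x = level_term (n + 1) x)"

class dually_ms_Stone_semi_heyting_algebra = dually_quasi_De_Morgan_semi_heyting_algebra +
  assumes dneg_sup: "dneg (x \<squnion> y) = dneg x \<sqinter> dneg y"
    and Stone: "pseudocompl x \<squnion> pseudocompl (pseudocompl x) = \<top>"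

end

theory Submission
  imports Defs
begin

text \<open>
  By the Stone identity every \<open>y = z\<^sup>*\<close> is complemented by \<open>y\<^sup>*\<close>, and on complemented elements
  the prime is an involution that commutes with the pseudocomplement. Hence
  \<open>y'\<^sup>*'\<^sup>* = y\<^sup>*''\<^sup>* = y\<^sup>*\<^sup>* = y\<close>; with \<open>y = x'\<^sup>*\<close>
  the factor that \<open>t\<^sub>3(x)\<close> adds to \<open>t\<^sub>2(x)\<close> already occurs in \<open>t\<^sub>1(x)\<close>.
\<close>

context semi_heyting_algebra
begin

text \<open>
  The operation \<open>\<rightarrow>\<close> itself need not be residuated, but \<open>x \<rightarrow> (x \<sqinter> y)\<close> is the Heyting implication.
\<close>

lemma le_sh_imp_inf_iff: "z \<le> x \<rightarrow> (x \<sqinter> y) \<longleftrightarrow> z \<sqinter> x \<le> y"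
proof
  assume "z \<le> x \<rightarrow> (x \<sqinter> y)"
  then have "z \<sqinter> x \<le> x \<sqinter> (x \<rightarrow> (x \<sqinter> y))"
    by (simp add: le_infI1)
  then show "z \<sqinter> x \<le> y"
    by (simp add: inf_sh_imp)
next
  assume "z \<sqinter> x \<le> y"
  then have "z \<sqinter> (x \<sqinter> y) = z \<sqinter> x"
    by (simp add: inf.absorb1 flip: inf.assoc)
  \<comment> \<open>Under the meet with \<open>z\<close>, both arguments of the arrow become
    \<open>z \<sqinter> x\<close>.\<close>
  then have "z \<sqinter> (x \<rightarrow> (x \<sqinter> y)) = z"
    using inf_sh_imp_inf[of z x "x \<sqinter> y"] by (simp add: sh_imp_refl)
  then show "z \<le> x \<rightarrow> (x \<sqinter> y)"
    by (simp add: inf.absorb_iff1)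
qed

text \<open>Residuation supplies the distributivity that the lattice axioms do not state.\<close>

lemma sup_inf_le:
  assumes "a \<sqinter> x \<le> y" "b \<sqinter> x \<le> y"
  shows "(a \<squnion> b) \<sqinter> x \<le> y"
  using assms by (simp flip: le_sh_imp_inf_iff)

lemma le_pseudocompl_iff: "x \<le> pseudocompl y \<longleftrightarrow> x \<sqinter> y = \<bottom>"
  using le_sh_imp_inf_iff[of x y \<bottom>] by (simp add: pseudocompl_def bot_unique)

lemma inf_pseudocompl: "x \<sqinter> pseudocompl x = \<bottom>"
  by (simp add: pseudocompl_def inf_sh_imp)

lemma pseudocompl_antimono: "x \<le> y \<Longrightarrow> pseudocompl y \<le> pseudocompl x"
  unfolding le_pseudocompl_iff
  by (metis bot_unique inf.commute inf_mono inf_pseudocompl order_refl)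

lemma le_pseudocompl_pseudocompl: "x \<le> pseudocompl (pseudocompl x)"
  by (simp add: le_pseudocompl_iff inf_pseudocompl)

lemma pseudocompl_triple: "pseudocompl (pseudocompl (pseudocompl x)) = pseudocompl x"
  by (intro order.antisym pseudocompl_antimono le_pseudocompl_pseudocompl)

lemma pseudocompl_eqI:
  assumes "u \<squnion> v = \<top>" "u \<sqinter> v = \<bottom>"
  shows "pseudocompl u = v"
proof (rule order.antisym)
  have "(u \<squnion> v) \<sqinter> pseudocompl u \<le> v"
    by (rule sup_inf_le) (simp_all add: inf_pseudocompl)
  then show "pseudocompl u \<le> v"
    by (simp add: assms(1))
  show "v \<le> pseudocompl u"
    using assms(2) by (simp add: le_pseudocompl_iff inf.commute)
qed

end

context dually_ms_Stone_semi_heyting_algebra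
begin

lemma dneg_complement:
  assumes "u \<squnion> v = \<top>" "u \<sqinter> v = \<bottom>"
  shows "dneg u \<squnion> dneg v = \<top>" "dneg u \<sqinter> dneg v = \<bottom>"
  using assms by (simp_all add: dneg_bot dneg_top flip: dneg_inf dneg_sup)

text \<open>The inequality missing from \<open>dneg_dneg_le\<close> comes from that axiom at the
  complement \<open>u\<close>: \<open>pseudocompl\<close> reverses the order and sends
  \<open>u\<close> to \<open>v\<close> and \<open>dneg (dneg u)\<close> to
  \<open>dneg (dneg v)\<close>.\<close>

lemma dneg_dneg_complemented:
  assumes "u \<squnion> v = \<top>" "u \<sqinter> v = \<bottom>"
  shows "dneg (dneg v) = v"
proof (rule order.antisym)
  have "pseudocompl u \<le> pseudocompl (dneg (dneg u))"
    by (intro pseudocompl_antimono dneg_dneg_le)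
  moreover have "pseudocompl u = v"
    by (intro pseudocompl_eqI assms)
  moreover have "pseudocompl (dneg (dneg u)) = dneg (dneg v)"
    by (intro pseudocompl_eqI dneg_complement assms)
  ultimately show "v \<le> dneg (dneg v)"
    by simp
qed (rule dneg_dneg_le)

lemma dneg_star_star_pseudocompl:
  "pseudocompl (dneg (pseudocompl (dneg (pseudocompl z)))) = pseudocompl z"
proof -
  let ?y = "pseudocompl z"
  note compl = Stone[of z] inf_pseudocompl[of ?y]
  have "pseudocompl (dneg ?y) = dneg (pseudocompl ?y)"
    by (intro pseudocompl_eqI dneg_complement compl)
  then show ?thesis
    by (simp add: dneg_dneg_complemented[OF compl] pseudocompl_triple)
qed

end

theorem theorem4p8:
  shows "at_level TYPE('a::dually_ms_Stone_semi_heyting_algebra) 2"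
  by (simp add: at_level_def numeral_eq_Suc dneg_star_star_pseudocompl inf.absorb1 le_infI1)

end
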